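(* Let $\mathcal H$ be a complex separable Hilbert space and let $T\in\mathcal B(\mathcal H)$ be an analytic left invertible $m$-concave operator for some $m\geqslant2$. If $T$ satisfies $$\beta_r(T)\geqslant\sum_{k=1}^\infty{L_T^*}^k\beta_{r+1}(T)L_T^k,\qquad r=1,\ldots,m-2,$$ then $T$ has the wandering subspace property.
   Context: For $T\in\mathcal B(\mathcal H)$ and $k\ge1$, $\beta_k(T):=\sum_{j=0}^k\binom kj(-1)^{k-j}{T^*}^jT^j$, and $\beta_0(T)=I$. $T$ is $m$-concave if $\beta_m(T)\leqslant0$; $T$ is analytic if $\bigcap_{n\ge0}T^n(\mathcal H)=\{0\}$. For a left invertible $T$, $L_T:=(T^*T)^{-1}T^*$. An inequality $B\geqslant\sum_{k=1}^\infty C_k$ between self-adjoint operators means that for every $x\in\mathcal H$ the series $\sum_k\langle C_kx,x\rangle$ converges and is at most $\langle Bx,x\rangle$. For $m=2$ the set of inequalities is vacuous. $T$ has the wandering subspace property if the closed linear span of $\{T^nx:x\in\ker T^*,\ n\geqslant0\}$ is $\mathcal H$. *)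

theory Defs
  imports "HOL-Analysis.Analysis" "HOL-Library.Complex_Order"
begin

class scaleC =
  fixes scaleC :: "complex \<Rightarrow> 'a \<Rightarrow> 'a"  (infixr "*\<^sub>C" 75)

class complex_vector = real_vector + scaleC +
  assumes scaleC_add_right: "a *\<^sub>C (x + y) = a *\<^sub>C x + a *\<^sub>C y"
    and scaleC_add_left: "(a + b) *\<^sub>C x = a *\<^sub>C x + b *\<^sub>C x"
    and scaleC_scaleC: "a *\<^sub>C b *\<^sub>C x = (a * b) *\<^sub>C x"
    and scaleR_scaleC: "r *\<^sub>R x = complex_of_real r *\<^sub>C x"

global_interpretation complex_vector: vector_space "scaleC :: complex \<Rightarrow> 'a \<Rightarrow> 'a :: complex_vector"
  defines cspan = complex_vector.span
proof
  show "1 *\<^sub>C x = x" for x :: 'a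
    using scaleR_scaleC[of 1 x] by simp
qed (simp_all add: scaleC_add_right scaleC_add_left scaleC_scaleC)

(* The inner product is linear in the first argument.  Every complex inner product space is a
   real one for the real part of cinner; this fixes the inherited real structure, so that
   positive definiteness and norm x = sqrt (Re (cinner x x)) come from real_inner. *)
class complex_inner = complex_vector + real_inner +
  fixes cinner :: "'a \<Rightarrow> 'a \<Rightarrow> complex"
  assumes cinner_commute: "cinner x y = cnj (cinner y x)"
    and cinner_add_left: "cinner (x + y) z = cinner x z + cinner y z"
    and cinner_scaleC_left: "cinner (c *\<^sub>C x) y = c * cinner x y"
    and inner_eq_Re_cinner: "inner x y = Re (cinner x y)"

class chilbert_space = complex_inner + complete_space

instantiation complex :: chilbert_space
begin

definition "a *\<^sub>C (z::complex) = a * z"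

definition "cinner (z::complex) w = z * cnj w"

instance
  by standard
    (simp_all add: scaleC_complex_def cinner_complex_def inner_complex_def scaleR_conv_of_real
      algebra_simps)

end

lemma power2_norm_eq_cinner:
  "complex_of_real ((norm x)\<^sup>2) = cinner x x" for x :: "'a::complex_inner"
proof -
  have "Im (cinner x x) = 0"
    using arg_cong[OF cinner_commute[of x x], of Im] by simp
  then show ?thesis
    by (simp add: complex_eq_iff power2_norm_eq_inner inner_eq_Re_cinner)
qed

definition bounded_clinear :: "('a::complex_inner \<Rightarrow> 'b::complex_inner) \<Rightarrow> bool" where
  "bounded_clinear T \<longleftrightarrow> bounded_linear T \<and> (\<forall>c x. T (c *\<^sub>C x) = c *\<^sub>C T x)"

definition cadjoint :: "('a::complex_inner \<Rightarrow> 'b::complex_inner) \<Rightarrow> 'b \<Rightarrow> 'a" where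
  "cadjoint T = (SOME S. \<forall>x y. cinner (T x) y = cinner x (S y))"

lemma cadjoint_unique:
  assumes "\<And>x y. cinner (T x) y = cinner x (S y)"
  shows "cadjoint T = S"
proof -
  have "\<forall>x y. cinner (T x) y = cinner x (cadjoint T y)"
    unfolding cadjoint_def by (rule someI[of _ S]) (simp add: assms)
  then have "inner x (cadjoint T y) = inner x (S y)" for x y
    using assms by (simp add: inner_eq_Re_cinner)
  then have "cadjoint T y = S y" for y
    using vector_eq_ldot[of "cadjoint T y" "S y"] by blast
  then show ?thesis
    by (rule ext)
qed

(* Comparisons between inner products below are in the order of HOL-Library.Complex_Order, in
   which z \<le> w means Re z \<le> Re w and Im z = Im w; on self-adjoint operators
   all the values compared are real. *)
definition op_le :: "('a::complex_inner \<Rightarrow> 'a) \<Rightarrow> ('a \<Rightarrow> 'a) \<Rightarrow> bool" where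
  "op_le A B \<longleftrightarrow> (\<forall>x. cinner (A x) x \<le> cinner (B x) x)"

(* op_series_le C B means C 1 + C 2 + ... \<le> B; the index starts at 1. *)
definition op_series_le :: "(nat \<Rightarrow> 'a::complex_inner \<Rightarrow> 'a) \<Rightarrow> ('a \<Rightarrow> 'a) \<Rightarrow> bool" where
  "op_series_le C B \<longleftrightarrow>
    (\<forall>x. summable (\<lambda>n. cinner (C (Suc n) x) x) \<and>
         (\<Sum>n. cinner (C (Suc n) x) x) \<le> cinner (B x) x)"

definition beta :: "nat \<Rightarrow> ('a::complex_inner \<Rightarrow> 'a) \<Rightarrow> 'a \<Rightarrow> 'a" where
  "beta k T x =
    (\<Sum>j=0..k. (real (k choose j) * (-1) ^ (k - j)) *\<^sub>R (cadjoint T ^^ j) ((T ^^ j) x))"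

definition m_concave :: "nat \<Rightarrow> ('a::complex_inner \<Rightarrow> 'a) \<Rightarrow> bool" where
  "m_concave m T \<longleftrightarrow> op_le (beta m T) (\<lambda>x. 0)"

definition analytic_op :: "('a::complex_inner \<Rightarrow> 'a) \<Rightarrow> bool" where
  "analytic_op T \<longleftrightarrow> (\<Inter>n. range (T ^^ n)) = {0}"

definition left_invertible :: "('a::complex_inner \<Rightarrow> 'a) \<Rightarrow> bool" where
  "left_invertible T \<longleftrightarrow> (\<exists>S. bounded_clinear S \<and> S \<circ> T = id)"

(* For left invertible T on a Hilbert space, cadjoint T \<circ> T is bijective, so that inv is its
   genuine inverse. *)
definition left_inv_op :: "('a::complex_inner \<Rightarrow> 'a) \<Rightarrow> 'a \<Rightarrow> 'a" where
  "left_inv_op T = inv (cadjoint T \<circ> T) \<circ> cadjoint T"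

definition wandering_subspace_property :: "('a::complex_inner \<Rightarrow> 'a) \<Rightarrow> bool" where
  "wandering_subspace_property T \<longleftrightarrow>
    closure (cspan {(T ^^ n) x | n x. cadjoint T x = 0}) = UNIV"

end

theory Submission
  imports Defs
begin

text \<open>
  Write $L$ for the left inverse $(T^*T)^{-1}T^*$ and $d_r(x) = \langle\beta_r(T)x,x\rangle$.
  Since $I - TL$ is the orthogonal projection onto $\ker T^*$, telescoping shows that
  $x - T^nL^nx$ lies in the span $M$ of the vectors $T^ke$ with $T^*e = 0$. If the remainders
  $T^nL^nx$ are bounded along a subsequence, then the closed ranges $T^k(\mathcal H)$, which
  decrease to $\{0\}$ by analyticity, leave $0$ as their only possible weak limit, so $x$ is a
  weak limit of elements of $M$ and hence lies in its closure. The lemma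
  \<open>wandering_subspace_property_if_remainders_bounded\<close> replaces weak compactness by the fact that
  nested bounded closed convex sets have a common point.

  The bound on the remainders is \<open>norm_power_left_inverse_frequently_bounded\<close>. The numbers
  $d_r(T^nx)$ form the difference table of the sequence $\|T^nx\|^2$. By $m$-concavity the $m$-th
  differences are nonpositive, so Newton's formula gives
  $\|T^nL^nx\|^2 \le \sum_{r<m}\binom nr d_r(L^nx)$. Nonnegativity of $\|T^nx\|^2$ forces
  $d_{m-1}\ge0$, and then the hypothesis $d_r(x)\ge\sum_k d_{r+1}(L^kx)$ gives $d_r\ge0$ for
  all $r\ge1$, from the top down. The same inequality for $r = 0$ holds automatically, because
  $\|TLy\|\le\|y\|$ makes the sum telescope. Iterating these inequalities yields
  $\sum_n\binom{n-1}{r-1}d_r(L^nx)\le\|x\|^2$ for $1\le r<m$. Since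
  $\binom nr\le n\binom{n-1}{r-1}$, the part of the Newton bound with $r\ge1$ is at most $n$ times
  the $n$-th term of a convergent series with nonnegative terms, so it is at most $1$ for
  infinitely many $n$, by divergence of the harmonic series. The remaining term $\|L^nx\|^2$ is at most
  $\|x\|^2$, because $d_1\ge0$ says that $T$ does not decrease norms.
\<close>

section \<open>Closed convex sets in a complete inner product space\<close>

text \<open>
  In infinite dimensions the sets need not be compact; convexity is what replaces compactness.
  Almost shortest vectors of the sets form a Cauchy sequence: midpoints stay in the sets, and so
  the parallelogram law bounds the distance of two such vectors by the gap of their lengths.
  Both the projection theorem and the final limit argument rest on this lemma.
\<close>
lemma nested_closed_convex_Int_nonempty:
  fixes C :: "nat \<Rightarrow> 'a::{real_inner, complete_space} set"
  assumes closed: "\<And>n. closed (C n)" and convex: "\<And>n. convex (C n)"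
    and nonempty: "\<And>n. C n \<noteq> {}" and decseq: "decseq C" and bounded: "bounded (C 0)"
  shows "(\<Inter>n. C n) \<noteq> {}"
proof -
  define q where "q n = (INF z\<in>C n. (norm z)\<^sup>2)" for n
  have bdd: "bdd_below ((\<lambda>z. (norm z)\<^sup>2) ` C n)" for n
    by (rule bdd_belowI[of _ 0]) auto
  have q_le: "q n \<le> (norm z)\<^sup>2" if "z \<in> C n" for n z
    unfolding q_def using bdd that by (rule cINF_lower)
  have sub: "C n \<subseteq> C k" if "k \<le> n" for k n
    using decseq that by (auto simp: decseq_def)
  have q_mono: "q k \<le> q n" if "k \<le> n" for k n
    unfolding q_def by (rule cINF_superset_mono[OF nonempty bdd sub[OF that]]) simp
  obtain B where B: "\<And>z. z \<in> C 0 \<Longrightarrow> norm z \<le> B"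
    using bounded by (auto simp: bounded_iff)
  have q_le_B: "q n \<le> B\<^sup>2" for n
  proof -
    obtain z where z: "z \<in> C n" using nonempty by auto
    then have "norm z \<le> B" using sub[of 0 n] B by auto
    then show ?thesis using q_le[OF z] power_mono[of "norm z" B 2] by simp
  qed
  have bdd_q: "bdd_above (range q)"
    by (rule bdd_aboveI[of _ "B\<^sup>2"]) (use q_le_B in auto)
  define Q where "Q = (SUP n. q n)"
  have q_le_Q: "q n \<le> Q" for n
    unfolding Q_def using bdd_q by (intro cSUP_upper) auto
  have q_lim: "q \<longlonglongrightarrow> Q"
    unfolding Q_def using bdd_q by (intro LIMSEQ_incseq_SUP) (auto simp: incseq_def q_mono)
  have "\<exists>z\<in>C n. (norm z)\<^sup>2 < q n + 1 / real (Suc n)" for n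
  proof -
    have "q n < q n + 1 / real (Suc n)" by simp
    then show ?thesis
      using cINF_less_iff[OF nonempty bdd] unfolding q_def by blast
  qed
  then obtain z where z: "\<And>n. z n \<in> C n" "\<And>n. (norm (z n))\<^sup>2 < q n + 1 / real (Suc n)"
    by metis
 
  \<comment> \<open>The midpoint of \<open>z n\<close> and \<open>z k\<close> lies in \<open>C n\<close>, so its squared norm is at least \<open>q n\<close>.\<close>
  have dist_le: "(dist (z n) (z k))\<^sup>2 \<le> 2 * (Q - q n) + 4 / real (Suc n)" if "n \<le> k" for n k
  proof -
    have "z k \<in> C n" using z(1)[of k] sub[OF that] by auto
    then have "(1/2) *\<^sub>R z n + (1/2) *\<^sub>R z k \<in> C n"
      using convex[of n] z(1)[of n] by (intro convexD) auto
    then have "q n \<le> (norm ((1/2) *\<^sub>R (z n + z k)))\<^sup>2"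
      using q_le by (simp add: scaleR_right_distrib)
    then have mid: "4 * q n \<le> (norm (z n + z k))\<^sup>2"
      by (simp add: power_divide)
    have "(norm (z n - z k))\<^sup>2 = 2 * (norm (z n))\<^sup>2 + 2 * (norm (z k))\<^sup>2 - (norm (z n + z k))\<^sup>2"
      by (simp add: power2_norm_eq_inner inner_simps inner_commute)
    moreover have "1 / real (Suc k) \<le> 1 / real (Suc n)"
      using that by (simp add: frac_le)
    ultimately show ?thesis
      using mid z(2)[of n] z(2)[of k] q_le_Q[of k] by (simp add: dist_norm)
  qed
  have lim0: "(\<lambda>n. 2 * (Q - q n) + 4 / real (Suc n)) \<longlonglongrightarrow> 2 * (Q - Q) + 0"
    by (intro tendsto_intros q_lim LIMSEQ_Suc[OF lim_const_over_n])
  have "Cauchy z"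
  proof (rule metric_CauchyI)
    fix e :: real assume "e > 0"
    then have "\<forall>\<^sub>F n in sequentially. 2 * (Q - q n) + 4 / real (Suc n) < (e/2)\<^sup>2"
      using order_tendstoD(2)[OF lim0, of "(e/2)\<^sup>2"] by simp
    then obtain N where N: "2 * (Q - q N) + 4 / real (Suc N) < (e/2)\<^sup>2"
      by (auto simp: eventually_sequentially)
    have "dist (z N) (z k) < e/2" if "N \<le> k" for k
      using dist_le[OF that] N \<open>e > 0\<close> by (intro power2_less_imp_less[of _ "e/2"]) auto
    then show "\<exists>M. \<forall>m\<ge>M. \<forall>n\<ge>M. dist (z m) (z n) < e"
      by (meson dist_commute_lessI dist_triangle_half_l)
  qed
  then obtain l where l: "z \<longlonglongrightarrow> l"
    using Cauchy_convergent convergentD by blast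
  have "l \<in> C n" for n
  proof (rule Lim_in_closed_set[OF closed _ _ l])
    show "\<forall>\<^sub>F k in sequentially. z k \<in> C n"
      using z(1) sub by (auto simp: eventually_sequentially intro!: exI[of _ n])
  qed simp
  then show ?thesis by auto
qed

text \<open>
  The sets of points of $V$ whose distance from $w$ exceeds the least one by at most $1/(n+1)$ are
  nested, so they share a point, which is a nearest point of $V$ to $w$.
\<close>
lemma orthogonal_projection_exists:
  fixes V :: "'a::{real_inner, complete_space} set"
  assumes "subspace V" "closed V"
  obtains p where "p \<in> V" "\<And>v. v \<in> V \<Longrightarrow> inner (w - p) v = 0"
proof -
  define C where "C n = V \<inter> cball w (infdist w V + 1 / real (Suc n))" for n
  have V0: "V \<noteq> {}" using subspace_0[OF assms(1)] by auto
  have "(\<Inter>n. C n) \<noteq> {}"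
  proof (rule nested_closed_convex_Int_nonempty)
    show "closed (C n)" "convex (C n)" for n
      using assms by (auto simp: C_def subspace_imp_convex intro: convex_Int)
    show "C n \<noteq> {}" for n
    proof -
      have "(INF v\<in>V. dist w v) < infdist w V + 1 / real (Suc n)"
        using V0 by (simp add: infdist_def)
      then obtain v where "v \<in> V" "dist w v < infdist w V + 1 / real (Suc n)"
        using cINF_less_iff[OF V0, of "dist w"] by (meson bdd_belowI2 zero_le_dist)
      then show ?thesis by (auto simp: C_def)
    qed
    show "decseq C"
      unfolding decseq_def
    proof (intro allI impI)
      fix k n :: nat assume "k \<le> n"
      then have "1 / real (Suc n) \<le> 1 / real (Suc k)" by (simp add: frac_le)
      then show "C n \<subseteq> C k" by (auto simp: C_def simp del: of_nat_Suc)
    qed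
    show "bounded (C 0)" by (simp add: C_def bounded_Int)
  qed
  then obtain p where p: "\<And>n. p \<in> C n" by auto
  have "(\<lambda>n. infdist w V + 1 / real (Suc n)) \<longlonglongrightarrow> infdist w V + 0"
    by (intro tendsto_intros LIMSEQ_Suc[OF lim_const_over_n])
  then have near: "dist w p \<le> infdist w V"
    using p by (intro LIMSEQ_le_const[where X = "\<lambda>n. infdist w V + 1 / real (Suc n)"])
      (auto simp: C_def)
  have pV: "p \<in> V" using p[of 0] by (simp add: C_def)
  have "inner (w - p) v = 0" if v: "v \<in> V" for v
  proof (cases "v = 0")
    case False
    \<comment> \<open>This \<open>t\<close> makes \<open>p + t v\<close> the point nearest to \<open>w\<close> on the line through \<open>p\<close> in direction \<open>v\<close>.\<close>
    define t where "t = inner (w - p) v / inner v v"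
    have "p + t *\<^sub>R v \<in> V" using assms(1) pV v by (simp add: subspace_add subspace_scale)
    then have "norm (w - p) \<le> norm (w - (p + t *\<^sub>R v))"
      using near infdist_le[of "p + t *\<^sub>R v" V w] by (simp add: dist_norm)
    then have "(norm (w - p))\<^sup>2 \<le> (norm ((w - p) - t *\<^sub>R v))\<^sup>2"
      by (simp add: algebra_simps power_mono)
    also have "\<dots> = (norm (w - p))\<^sup>2 - 2 * t * inner (w - p) v + t\<^sup>2 * inner v v"
      unfolding power2_norm_eq_inner
      by (simp add: inner_diff_left inner_diff_right inner_commute power2_eq_square algebra_simps)
    also have "\<dots> = (norm (w - p))\<^sup>2 - (inner (w - p) v)\<^sup>2 / inner v v"
      using False by (simp add: t_def power2_eq_square)
    finally have "(inner (w - p) v)\<^sup>2 / inner v v \<le> 0" by simp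
    moreover have "inner v v > 0" using False by simp
    ultimately show ?thesis
      by (simp add: divide_le_0_iff)
  qed simp
  with pV that show thesis by blast
qed

text \<open>
  A nonzero functional is represented by a multiple of a normal vector to its kernel.
\<close>
lemma riesz_representation:
  fixes f :: "'a::{real_inner, complete_space} \<Rightarrow> real"
  assumes "bounded_linear f"
  obtains y where "\<And>x. f x = inner x y"
proof (cases "\<forall>x. f x = 0")
  case True
  then show thesis using that[of 0] by simp
next
  case False
  interpret f: bounded_linear f by fact
  obtain a where a: "f a \<noteq> 0" using False by auto
  have sub: "subspace {x. f x = 0}"
    by (auto simp: subspace_def f.add f.scaleR f.zero)
  have "closed {x. f x = 0}"
    by (intro closed_Collect_eq continuous_intros f.continuous_on)
  then obtain p where p: "f p = 0" "\<And>v. f v = 0 \<Longrightarrow> inner (a - p) v = 0"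
    using orthogonal_projection_exists[OF sub, of a] by auto
  define n where "n = a - p"
  have fn: "f n \<noteq> 0" using a p(1) by (simp add: n_def f.diff)
  then have n0: "inner n n \<noteq> 0" by (auto simp: f.zero)
  have "f x = inner x ((f n / inner n n) *\<^sub>R n)" for x
  proof -
    have "f (x - (f x / f n) *\<^sub>R n) = 0" using fn by (simp add: f.diff f.scaleR)
    then have "inner n (x - (f x / f n) *\<^sub>R n) = 0" using p(2) by (simp add: n_def)
    then have "inner x n = (f x / f n) * inner n n"
      by (simp add: inner_diff_right inner_commute)
    then show ?thesis using fn n0 by simp
  qed
  then show thesis by (rule that)
qed

section \<open>Adjoints\<close>

lemma bounded_clinearD:
  assumes "bounded_clinear T"
  shows "bounded_linear T" "T (c *\<^sub>C x) = c *\<^sub>C T x"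
    "T (x + y) = T x + T y" "T (x - y) = T x - T y" "T (r *\<^sub>R x) = r *\<^sub>R T x" "T 0 = 0"
proof -
  show "bounded_linear T" "T (c *\<^sub>C x) = c *\<^sub>C T x"
    using assms by (auto simp: bounded_clinear_def)
  then show "T (x + y) = T x + T y" "T (x - y) = T x - T y" "T (r *\<^sub>R x) = r *\<^sub>R T x" "T 0 = 0"
    by (simp_all add: bounded_linear.linear linear_add linear_diff linear_scale linear_0)
qed

lemma Im_cinner: "Im (cinner x y) = - inner (\<i> *\<^sub>C x) y"
  for x y :: "'a::complex_inner"
  by (simp add: inner_eq_Re_cinner cinner_scaleC_left)

text \<open>
  Existence of the adjoint. The Riesz theorem is applied to the real inner product only;
  complex linearity of $T$ recovers the imaginary part, since it is a real inner product with
  $ix$ in place of $x$.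
\<close>
lemma cinner_cadjoint:
  fixes T :: "'a::chilbert_space \<Rightarrow> 'b::chilbert_space"
  assumes T: "bounded_clinear T"
  shows "cinner (T x) y = cinner x (cadjoint T y)"
proof -
  have "\<exists>s. \<forall>x. inner (T x) y = inner x s" for y
  proof -
    have "bounded_linear (\<lambda>x. inner (T x) y)"
      by (rule bounded_linear_inner_left_comp[OF bounded_clinearD(1)[OF T]])
    then show ?thesis by (metis riesz_representation)
  qed
  then obtain S where S: "\<And>x y. inner (T x) y = inner x (S y)" by metis
  have "cinner (T x) y = cinner x (S y)" for x y
  proof (rule complex_eqI)
    show "Re (cinner (T x) y) = Re (cinner x (S y))"
      using S[of x y] by (simp only: inner_eq_Re_cinner)
    show "Im (cinner (T x) y) = Im (cinner x (S y))"
      using S[of "\<i> *\<^sub>C x" y] by (simp only: Im_cinner bounded_clinearD(2)[OF T])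
  qed
  with cadjoint_unique[of T S] show ?thesis by simp
qed

lemma inner_cadjoint:
  fixes T :: "'a::chilbert_space \<Rightarrow> 'b::chilbert_space"
  assumes "bounded_clinear T"
  shows "inner (T x) y = inner x (cadjoint T y)"
  by (simp add: inner_eq_Re_cinner cinner_cadjoint[OF assms])

lemma cinner_scaleC_right: "cinner x (c *\<^sub>C y) = cnj c * cinner x y"
  for x y :: "'a::complex_inner"
  by (metis cinner_commute cinner_scaleC_left complex_cnj_mult)

lemma cinner_eq_imp_eq:
  fixes u v :: "'a::complex_inner"
  assumes "\<And>x. cinner x u = cinner x v"
  shows "u = v"
  using vector_eq_ldot[of u v] assms by (auto simp: inner_eq_Re_cinner)

lemma cadjoint_scaleC:
  fixes T :: "'a::chilbert_space \<Rightarrow> 'b::chilbert_space"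
  assumes "bounded_clinear T"
  shows "cadjoint T (c *\<^sub>C y) = c *\<^sub>C cadjoint T y"
  by (rule cinner_eq_imp_eq)
    (simp add: cinner_scaleC_right flip: cinner_cadjoint[OF assms])

lemma linear_cadjoint:
  fixes T :: "'a::chilbert_space \<Rightarrow> 'b::chilbert_space"
  assumes "bounded_clinear T"
  shows "linear (cadjoint T)"
proof (rule linearI)
  show "cadjoint T (x + y) = cadjoint T x + cadjoint T y" for x y
    using vector_eq_ldot[of "cadjoint T (x + y)" "cadjoint T x + cadjoint T y"]
    by (simp add: inner_add_right flip: inner_cadjoint[OF assms])
  show "cadjoint T (r *\<^sub>R x) = r *\<^sub>R cadjoint T x" for r x
    by (simp add: scaleR_scaleC cadjoint_scaleC[OF assms])
qed

lemma cinner_funpow_cadjoint: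
  fixes T :: "'a::chilbert_space \<Rightarrow> 'a"
  assumes "bounded_clinear T"
  shows "cinner ((cadjoint T ^^ k) y) x = cinner y ((T ^^ k) x)"
proof (induction k arbitrary: x)
  case (Suc k)
  have "cinner (cadjoint T z) x = cinner z (T x)" for z
    using cinner_cadjoint[OF assms, of x z] by (metis cinner_commute)
  then show ?case using Suc[of "T x"] by (simp add: funpow_swap1[of T])
qed simp

section \<open>The left inverse with the same kernel as the adjoint\<close>

text \<open>
  If $S$ is a bounded left inverse of $T$, then the range of $T^n$ is the fixed point set of the
  continuous map $T^nS^n$.
\<close>
lemma left_invertible_imp_closed_range:
  fixes T :: "'a::complex_inner \<Rightarrow> 'a"
  assumes "bounded_clinear T" "left_invertible T"
  shows "closed (range (T ^^ n))"
proof -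
  obtain S where S: "bounded_clinear S" "S \<circ> T = id"
    using assms by (auto simp: left_invertible_def)
  have ST: "(S ^^ n) ((T ^^ n) x) = x" for x
  proof (induction n arbitrary: x)
    case (Suc n)
    have "S (T y) = y" for y using S(2) by (metis comp_apply id_apply)
    then show ?case using Suc by (simp add: funpow_swap1)
  qed simp
  have cont: "continuous_on UNIV (f ^^ n)" if "bounded_clinear f" for f :: "'a \<Rightarrow> 'a"
  proof (induction n)
    case (Suc n)
    then show ?case
      using continuous_on_compose[OF Suc, of f] that
      by (simp add: bounded_clinearD linear_continuous_on)
  qed (simp add: id_def)
  have "range (T ^^ n) = {y. (T ^^ n) ((S ^^ n) y) = y}"
    using ST by (auto, metis rangeI)
  moreover have "continuous_on UNIV (\<lambda>y. (T ^^ n) ((S ^^ n) y))"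
    using continuous_on_compose2[OF cont[OF assms(1)] cont[OF S(1)]] by simp
  ultimately show ?thesis
    by (simp add: closed_Collect_eq continuous_on_id)
qed

text \<open>
  The normal equation $T^*TLy = T^*y$ determines $Ly$, because $T^*T$ is injective. It is solvable because the projection $Tz$ of $y$ onto the closed range of $T$
  satisfies $T^*(y - Tz) = 0$; this makes \<open>inv\<close> in the definition of $L$ a genuine inverse
  on the range of $T^*$.
\<close>
lemma left_inv_op_normal_equation:
  fixes T :: "'a::chilbert_space \<Rightarrow> 'a"
  assumes T: "bounded_clinear T" "left_invertible T"
  shows "inj (cadjoint T \<circ> T)" "cadjoint T (T (left_inv_op T y)) = cadjoint T y"
proof -
  obtain S where S: "bounded_clinear S" "S \<circ> T = id"
    using T by (auto simp: left_invertible_def)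
  have inj_T: "x = y" if "T x = T y" for x y
    using that S(2) by (metis comp_apply id_apply)
  interpret A: linear "cadjoint T" by (rule linear_cadjoint[OF T(1)])
  show "inj (cadjoint T \<circ> T)"
  proof (rule injI)
    fix x y assume "(cadjoint T \<circ> T) x = (cadjoint T \<circ> T) y"
    then have "cadjoint T (T (x - y)) = 0" by (simp add: A.diff bounded_clinearD[OF T(1)])
    then have "inner (T (x - y)) (T (x - y)) = 0" by (simp add: inner_cadjoint[OF T(1)])
    then show "x = y" using inj_T by (simp add: bounded_clinearD[OF T(1)])
  qed
  have sub: "subspace (range T)"
    using bounded_linear.linear[OF bounded_clinearD(1)[OF T(1)]] by (simp add: linear_subspace_image)
  have "closed (range T)"
    using left_invertible_imp_closed_range[OF T, of 1] by simp
  then obtain z where "\<And>v. inner (y - T z) (T v) = 0"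
    using orthogonal_projection_exists[OF sub, of y] by (metis rangeE rangeI)
  then have "inner v (cadjoint T (y - T z)) = 0" for v
    using inner_cadjoint[OF T(1), of v "y - T z"] by (simp add: inner_commute)
  then have "cadjoint T (y - T z) = 0"
    using vector_eq_ldot[of "cadjoint T (y - T z)" 0] by simp
  then have "cadjoint T y \<in> range (cadjoint T \<circ> T)"
    by (auto simp: A.diff)
  then show "cadjoint T (T (left_inv_op T y)) = cadjoint T y"
    using f_inv_into_f[of "cadjoint T y" "cadjoint T \<circ> T" UNIV] by (simp add: left_inv_op_def)
qed

lemma left_inv_op_eqI:
  fixes T :: "'a::chilbert_space \<Rightarrow> 'a"
  assumes "bounded_clinear T" "left_invertible T" "cadjoint T (T z) = cadjoint T y"
  shows "left_inv_op T y = z"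
  using left_inv_op_normal_equation[OF assms(1,2)] assms(3) by (metis comp_apply injD)

text \<open>
  $TL$ is the orthogonal projection onto the range of $T$.
\<close>
lemma norm_T_left_inv_op_le:
  fixes T :: "'a::chilbert_space \<Rightarrow> 'a"
  assumes T: "bounded_clinear T" "left_invertible T"
  shows "norm (T (left_inv_op T y)) \<le> norm y"
proof -
  let ?p = "T (left_inv_op T y)"
  have "cadjoint T (y - ?p) = 0"
    using left_inv_op_normal_equation(2)[OF T] linear_cadjoint[OF T(1)] by (simp add: linear_diff)
  then have "inner ?p (y - ?p) = 0" by (simp add: inner_cadjoint[OF T(1)])
  then have "(norm ?p)\<^sup>2 = inner ?p y"
    by (simp add: inner_diff_right power2_norm_eq_inner)
  also have "\<dots> \<le> norm ?p * norm y" by (rule norm_cauchy_schwarz)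
  finally have "norm ?p * norm ?p \<le> norm ?p * norm y" by (simp add: power2_eq_square)
  then show ?thesis by (cases "norm ?p = 0") auto
qed

lemma bounded_clinear_left_inv_op:
  fixes T :: "'a::chilbert_space \<Rightarrow> 'a"
  assumes T: "bounded_clinear T" "left_invertible T"
  shows "bounded_clinear (left_inv_op T)"
proof -
  obtain S where S: "bounded_clinear S" "S \<circ> T = id"
    using T by (auto simp: left_invertible_def)
  obtain K where K: "\<And>x. norm (S x) \<le> norm x * K" "K \<ge> 0"
    using bounded_linear.nonneg_bounded[OF bounded_clinearD(1)[OF S(1)]] by blast
  interpret A: linear "cadjoint T" by (rule linear_cadjoint[OF T(1)])
  note simps = A.add A.scale bounded_clinearD[OF T(1)] left_inv_op_normal_equation(2)[OF T]
    cadjoint_scaleC[OF T(1)]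
  have "bounded_linear (left_inv_op T)"
  proof (rule bounded_linear_intro[where K = K])
    show "left_inv_op T (x + y) = left_inv_op T x + left_inv_op T y" for x y
      by (rule left_inv_op_eqI[OF T]) (simp add: simps)
    show "left_inv_op T (r *\<^sub>R x) = r *\<^sub>R left_inv_op T x" for r x
      by (rule left_inv_op_eqI[OF T]) (simp add: simps)
    show "norm (left_inv_op T x) \<le> norm x * K" for x
    proof -
      have "norm (left_inv_op T x) = norm (S (T (left_inv_op T x)))"
        using S(2) by (metis comp_apply id_apply)
      also have "\<dots> \<le> norm (T (left_inv_op T x)) * K" by (rule K)
      also have "\<dots> \<le> norm x * K"
        by (intro mult_right_mono norm_T_left_inv_op_le[OF T] K)
      finally show ?thesis .
    qed
  qed
  moreover have "left_inv_op T (c *\<^sub>C x) = c *\<^sub>C left_inv_op T x" for c x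
    by (rule left_inv_op_eqI[OF T]) (simp add: simps)
  ultimately show ?thesis by (simp add: bounded_clinear_def)
qed

section \<open>Difference tables\<close>

text \<open>
  Pascal's rule for iterated forward differences. The coefficient with $j = r+1$ vanishes, which
  makes the truncated exponents on the natural numbers harmless.
\<close>
lemma binomial_alternating_sum_Suc:
  fixes a :: "nat \<Rightarrow> real"
  shows "(\<Sum>j\<le>Suc r. real (Suc r choose j) * (-1) ^ (Suc r - j) * a j) =
    (\<Sum>j\<le>r. real (r choose j) * (-1) ^ (r - j) * a (Suc j)) -
    (\<Sum>j\<le>r. real (r choose j) * (-1) ^ (r - j) * a j)"
proof -
  have flip: "real (r choose Suc j) * (-1) ^ (r - j) * a (Suc j) =
      - (real (r choose Suc j) * (-1) ^ (r - Suc j) * a (Suc j))" for j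
  proof (cases "j < r")
    case True
    then have "r - j = Suc (r - Suc j)" by simp
    then show ?thesis by simp
  qed (simp add: binomial_eq_0)
  have "(\<Sum>j\<le>r. real (r choose j) * (-1) ^ (r - j) * a j) =
      (\<Sum>j\<le>Suc r. real (r choose j) * (-1) ^ (r - j) * a j)"
    by simp
  also have "\<dots> = (-1) ^ r * a 0 +
      (\<Sum>j\<le>r. real (r choose Suc j) * (-1) ^ (r - Suc j) * a (Suc j))"
    by (subst sum.atMost_Suc_shift) simp
  finally have low: "(\<Sum>j\<le>r. real (r choose j) * (-1) ^ (r - j) * a j) =
    (-1) ^ r * a 0 + (\<Sum>j\<le>r. real (r choose Suc j) * (-1) ^ (r - Suc j) * a (Suc j))" .
  have "(\<Sum>j\<le>Suc r. real (Suc r choose j) * (-1) ^ (Suc r - j) * a j) =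
      - ((-1) ^ r * a 0) +
      (\<Sum>j\<le>r. real (r choose j) * (-1) ^ (r - j) * a (Suc j) +
              real (r choose Suc j) * (-1) ^ (r - j) * a (Suc j))"
    by (subst sum.atMost_Suc_shift) (simp add: distrib_right)
  also have "\<dots> = (\<Sum>j\<le>r. real (r choose j) * (-1) ^ (r - j) * a (Suc j)) -
    (\<Sum>j\<le>r. real (r choose j) * (-1) ^ (r - j) * a j)"
    unfolding low by (simp add: flip sum.distrib sum_subtractf sum_negf)
  finally show ?thesis .
qed

text \<open>
  Newton's expansion of the first row of a difference table, cut off at a row that is nonpositive.
  The induction on $n$ needs the statement for the rows $m-q$ as well, since each step
  adds two adjacent rows.
\<close>
lemma newton_forward_difference_le:
  fixes f :: "nat \<Rightarrow> nat \<Rightarrow> real"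
  assumes diff: "\<And>r n. f (Suc r) n = f r (Suc n) - f r n" and concave: "\<And>n. f m n \<le> 0"
  shows "f 0 n \<le> (\<Sum>k<m. real (n choose k) * f k 0)"
proof -
  have "f (m - q) n \<le> (\<Sum>i<q. real (n choose i) * f (m - q + i) 0)" if "q \<le> m" for q
    using that
  proof (induction n arbitrary: q)
    case 0
    show ?case
    proof (cases q)
      case 0
      then show ?thesis using concave by simp
    next
      case (Suc q')
      then show ?thesis by (simp add: sum.lessThan_Suc_shift del: sum.lessThan_Suc)
    qed
  next
    case (Suc n)
    show ?case
    proof (cases q)
      case 0
      then show ?thesis using concave by simp
    next
      case q: (Suc q')
      have m: "m - q' = Suc (m - q)" using Suc.prems q by simp
      have "f (m - q) (Suc n) = f (m - q) n + f (m - q') n"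
        by (simp add: m diff)
      also have "\<dots> \<le> (\<Sum>i<q. real (n choose i) * f (m - q + i) 0) +
          (\<Sum>i<q'. real (n choose i) * f (m - q' + i) 0)"
        using Suc.IH[of q] Suc.IH[of q'] Suc.prems q by simp
      also have "\<dots> = (\<Sum>i<q. real (Suc n choose i) * f (m - q + i) 0)"
        unfolding q m[unfolded q]
        by (simp add: sum.lessThan_Suc_shift distrib_right sum.distrib del: sum.lessThan_Suc)
      finally show ?thesis .
    qed
  qed
  from this[of m] show ?thesis by simp
qed

text \<open>
  Otherwise the row $p$, which is nonincreasing, stays below a negative constant; summation then
  drives row $p-1$ to $-\infty$, and so on up to row $0$, which would become negative.
\<close>
lemma last_difference_nonneg:
  fixes f :: "nat \<Rightarrow> nat \<Rightarrow> real"
  assumes diff: "\<And>r n. f (Suc r) n = f r (Suc n) - f r n"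
    and concave: "\<And>n. f (Suc p) n \<le> 0" and nonneg: "\<And>n. f 0 n \<ge> 0"
  shows "f p 0 \<ge> 0"
proof (rule ccontr)
  assume neg: "\<not> f p 0 \<ge> 0"
  define e where "e = - f p 0"
  have "e > 0" using neg by (simp add: e_def)
  have "\<exists>N. \<forall>n\<ge>N. f (p - q) n \<le> - e" if "q \<le> p" for q
    using that
  proof (induction q)
    case 0
    have "f p n \<le> - e" for n
    proof (induction n)
      case (Suc n)
      then show ?case using concave[of n] diff[of p n] by simp
    qed (simp add: e_def)
    then show ?case by auto
  next
    case (Suc q)
    then obtain N where N: "\<And>n. n \<ge> N \<Longrightarrow> f (p - q) n \<le> - e" by auto
    have "p - q = Suc (p - Suc q)" using Suc.prems by simp
    then have step: "f (p - Suc q) (Suc n) \<le> f (p - Suc q) n - e" if "n \<ge> N" for n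
      using N[OF that] diff[of "p - Suc q" n] by simp
    have drop: "f (p - Suc q) (N + k) \<le> f (p - Suc q) N - real k * e" for k
    proof (induction k)
      case (Suc k)
      then show ?case using step[of "N + k"] by (simp add: algebra_simps)
    qed simp
    obtain k0 where k0: "f (p - Suc q) N + e < real k0 * e"
      using reals_Archimedean3[OF \<open>e > 0\<close>] by blast
    have "f (p - Suc q) n \<le> - e" if "n \<ge> N + k0" for n
    proof -
      have "real k0 * e \<le> real (n - N) * e" using that \<open>e > 0\<close> by simp
      then show ?thesis using drop[of "n - N"] k0 that by simp
    qed
    then show ?case by blast
  qed
  from this[of p] obtain N where "f 0 N \<le> - e" by auto
  with nonneg[of N] \<open>e > 0\<close> show False by simp
qed

text \<open>
  If $(n+1)s_n > 1$ from some point on, the harmonic series would converge by comparison.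
\<close>
lemma bounded_sums_imp_frequently_small:
  fixes s :: "nat \<Rightarrow> real"
  assumes "\<And>n. s n \<ge> 0" and "\<And>N. (\<Sum>n<N. s n) \<le> C"
  shows "\<exists>n\<ge>N. real (Suc n) * s n \<le> 1"
proof (rule ccontr)
  assume "\<not> ?thesis"
  then have big: "1 < real (Suc n) * s n" if "n \<ge> N" for n using that by force
  have "summable s" by (rule summableI_nonneg_bounded) (use assms in auto)
  then have "summable (\<lambda>n. 1 / real (Suc n))"
  proof (rule summable_comparison_test_ev[rotated])
    show "\<forall>\<^sub>F n in sequentially. norm (1 / real (Suc n)) \<le> s n"
      unfolding eventually_sequentially
    proof (intro exI[of _ N] allI impI)
      fix n assume "N \<le> n"
      from big[OF this] show "norm (1 / real (Suc n)) \<le> s n"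
        by (simp add: divide_le_eq mult.commute)
    qed
  qed
  then show False
    using not_summable_harmonic[where 'a = real] summable_Suc_iff[of "\<lambda>n. 1 / real n"]
    by (simp only: inverse_eq_divide simp_thms)
qed

section \<open>The quadratic forms of the defect operators\<close>

text \<open>
  The real number $\langle\beta_r(T)x,x\rangle$, written without the adjoint: the $r$-th forward
  difference at $0$ of the sequence $\|T^nx\|^2$.
\<close>
definition defect :: "('a::real_normed_vector \<Rightarrow> 'a) \<Rightarrow> nat \<Rightarrow> 'a \<Rightarrow> real" where
  "defect T r x = (\<Sum>j\<le>r. real (r choose j) * (-1) ^ (r - j) * (norm ((T ^^ j) x))\<^sup>2)"

lemma defect_0 [simp]: "defect T 0 x = (norm x)\<^sup>2"
  by (simp add: defect_def)

lemma defect_Suc: "defect T (Suc r) x = defect T r (T x) - defect T r x"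
  using binomial_alternating_sum_Suc[of r "\<lambda>j. (norm ((T ^^ j) x))\<^sup>2"]
  by (simp add: defect_def funpow_swap1 del: sum.atMost_Suc)

lemma cinner_beta:
  fixes T :: "'a::chilbert_space \<Rightarrow> 'a"
  assumes T: "bounded_clinear T"
  shows "cinner (beta r T x) x = complex_of_real (defect T r x)"
proof -
  have sum_left: "cinner (sum g A) z = (\<Sum>j\<in>A. cinner (g j) z)"
    for g :: "nat \<Rightarrow> 'a" and A z
  proof -
    have "cinner 0 z = 0" using cinner_add_left[of 0 0 z] by simp
    then show ?thesis
      by (induction A rule: infinite_finite_induct) (simp_all add: cinner_add_left)
  qed
  show ?thesis
    unfolding beta_def defect_def atLeast0AtMost sum_left scaleR_scaleC cinner_scaleC_left
      cinner_funpow_cadjoint[OF T] power2_norm_eq_cinner[symmetric] by simp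
qed

lemma defect_orbit_diff:
  "defect T (Suc r) ((T ^^ n) x) = defect T r ((T ^^ Suc n) x) - defect T r ((T ^^ n) x)"
  by (simp add: defect_Suc)

section \<open>Bounding the remainders of the Wold-type expansion\<close>

text \<open>
  The inequalities $d_r(x)\ge\sum_k d_{r+1}(L^kx)$ are iterated by inserting the bound for $d_{s+1}$
  at the points $L^{k+1}x$ into the weighted sum for $s$. Exchanging the order of summation, the
  new weights are $\sum_{k<n}\binom ks = \binom n{s+1}$. For $s = 0$ the sum telescopes.
\<close>
lemma defect_weighted_sum_le:
  fixes T L :: "'a::real_normed_vector \<Rightarrow> 'a"
  assumes contr: "\<And>y. norm (T (L y)) \<le> norm y"
    and step: "\<And>r x N. 1 \<le> r \<Longrightarrow> r < p \<Longrightarrow>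
      (\<Sum>k<N. defect T (Suc r) ((L ^^ Suc k) x)) \<le> defect T r x"
    and "s < p"
  shows "(\<Sum>n<N. real (n choose s) * defect T (Suc s) ((L ^^ Suc n) x)) \<le> (norm x)\<^sup>2"
  using \<open>s < p\<close>
proof (induction s arbitrary: N)
  case 0
  have "(\<Sum>n<N. defect T (Suc 0) ((L ^^ Suc n) x)) \<le> (norm x)\<^sup>2 - (norm ((L ^^ N) x))\<^sup>2"
  proof (induction N)
    case (Suc N)
    have "(norm (T ((L ^^ Suc N) x)))\<^sup>2 \<le> (norm ((L ^^ N) x))\<^sup>2"
      using contr[of "(L ^^ N) x"] by (simp add: power_mono)
    then show ?case using Suc unfolding sum.lessThan_Suc defect_Suc defect_0 by (simp only: funpow.simps comp_apply)
  qed simp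
  also have "\<dots> \<le> (norm x)\<^sup>2" by simp
  finally show ?case by simp
next
  case (Suc s)
  define g where "g n = defect T (Suc (Suc s)) ((L ^^ Suc n) x)" for n
  have choose: "real (n choose Suc s) = (\<Sum>k<n. real (k choose s))" for n
    by (induction n) simp_all
  have "(\<Sum>n<N. real (n choose Suc s) * g n) = (\<Sum>n<N. \<Sum>k<n. real (k choose s) * g n)"
    by (simp add: choose sum_distrib_right)
  \<comment> \<open>Exchange of the order of summation over \<open>k < n < N\<close>, with \<open>n = k + 1 + j\<close>.\<close>
  also have "\<dots> = (\<Sum>k<N. \<Sum>j<N - Suc k. real (k choose s) * g (Suc k + j))"
  proof (induction N)
    case (Suc N)
    have "(\<Sum>k<N. \<Sum>j<Suc N - Suc k. real (k choose s) * g (Suc k + j)) =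
        (\<Sum>k<N. (\<Sum>j<N - Suc k. real (k choose s) * g (Suc k + j)) + real (k choose s) * g N)"
    proof (rule sum.cong[OF refl])
      fix k assume "k \<in> {..<N}"
      then have "Suc N - Suc k = Suc (N - Suc k)" "Suc k + (N - Suc k) = N" by auto
      then show "(\<Sum>j<Suc N - Suc k. real (k choose s) * g (Suc k + j)) =
          (\<Sum>j<N - Suc k. real (k choose s) * g (Suc k + j)) + real (k choose s) * g N"
        by (metis sum.lessThan_Suc)
    qed
    then show ?case using Suc by (simp add: sum.distrib)
  qed simp
  also have "\<dots> = (\<Sum>k<N. real (k choose s) * (\<Sum>j<N - Suc k. g (Suc k + j)))"
    by (simp add: sum_distrib_left)
  also have "\<dots> \<le> (\<Sum>k<N. real (k choose s) * defect T (Suc s) ((L ^^ Suc k) x))"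
  proof (intro sum_mono mult_left_mono)
    fix k
    have "g (Suc k + j) = defect T (Suc (Suc s)) ((L ^^ Suc j) ((L ^^ Suc k) x))" for j
      by (simp add: g_def funpow_add[symmetric] add.commute flip: comp_apply[of "L ^^ _" "L ^^ _"] funpow.simps(2))
    then show "(\<Sum>j<N - Suc k. g (Suc k + j)) \<le> defect T (Suc s) ((L ^^ Suc k) x)"
      using step[of "Suc s" "(L ^^ Suc k) x" "N - Suc k"] Suc.prems by simp
  qed simp
  also have "\<dots> \<le> (norm x)\<^sup>2" using Suc by simp
  finally show ?case by (simp add: g_def)
qed

text \<open>
  Here $p = m-1$. The hypothesis on the series is stated for the whole series, and only after
  positivity of all $d_r$ is known does it control the partial sums.
\<close>
lemma norm_power_left_inverse_frequently_bounded:
  fixes T L :: "'a::real_normed_vector \<Rightarrow> 'a"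
  assumes contr: "\<And>y. norm (T (L y)) \<le> norm y"
    and summable: "\<And>r x. 1 \<le> r \<Longrightarrow> r < p \<Longrightarrow>
      summable (\<lambda>k. defect T (Suc r) ((L ^^ Suc k) x))"
    and series_le: "\<And>r x. 1 \<le> r \<Longrightarrow> r < p \<Longrightarrow>
      (\<Sum>k. defect T (Suc r) ((L ^^ Suc k) x)) \<le> defect T r x"
    and "p \<ge> 1" and concave: "\<And>x. defect T (Suc p) x \<le> 0"
  shows "\<exists>n\<ge>N. (norm ((T ^^ n) ((L ^^ n) x)))\<^sup>2 \<le> (norm x)\<^sup>2 + 1"
proof -
  have orbit: "defect T (Suc r) ((T ^^ n) x) = defect T r ((T ^^ Suc n) x) - defect T r ((T ^^ n) x)"
    for r n x by (rule defect_orbit_diff)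
  have top: "defect T p x \<ge> 0" for x
    using last_difference_nonneg[of "\<lambda>r n. defect T r ((T ^^ n) x)" p, OF orbit] concave by simp
  \<comment> \<open>Positivity propagates downwards from the top row through the hypothesis on the series.\<close>
  have nonneg: "defect T (p - q) x \<ge> 0" if "q < p" for q x
    using that
  proof (induction q arbitrary: x)
    case (Suc q)
    then have eq: "p - q = Suc (p - Suc q)" by simp
    have r: "1 \<le> p - Suc q" "p - Suc q < p" using Suc.prems by auto
    have "0 \<le> (\<Sum>k. defect T (p - q) ((L ^^ Suc k) x))"
      unfolding eq by (intro suminf_nonneg summable[OF r]) (use Suc eq in simp)
    also have "\<dots> \<le> defect T (p - Suc q) x"
      using series_le[OF r] unfolding eq .
    finally show ?case .
  qed (simp add: top)
  have nonneg': "defect T (Suc s) x \<ge> 0" if "s < p" for s x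
    using nonneg[of "p - Suc s" x] that by (simp add: Suc_diff_Suc)
  have step: "(\<Sum>k<N. defect T (Suc r) ((L ^^ Suc k) x)) \<le> defect T r x"
    if "1 \<le> r" "r < p" for r x N
    using sum_le_suminf[OF summable[OF that], of "{..<N}"] series_le[OF that, of x] nonneg'[of r] that(2)
    by (simp del: funpow.simps) (meson order_trans)
  have L_contr: "norm ((L ^^ n) x) \<le> norm x" for n
  proof (induction n)
    case (Suc n)
    let ?y = "(L ^^ n) x"
    have "(norm (L ?y))\<^sup>2 \<le> (norm (T (L ?y)))\<^sup>2"
      using nonneg'[of 0 "L ?y"] \<open>p \<ge> 1\<close> by (simp add: defect_Suc)
    then have "norm (L ?y) \<le> norm (T (L ?y))" by (rule power2_le_imp_le) simp
    with contr[of ?y] Suc show ?case by simp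
  qed simp
  \<comment> \<open>The \<open>w n\<close> form a convergent series, and the terms after the first in the Newton bound at \<open>n + 1\<close> add up to at most \<open>(n + 1) * w n\<close>.\<close>
  define w where "w n = (\<Sum>s<p. real (n choose s) * defect T (Suc s) ((L ^^ Suc n) x))" for n
  have w_nonneg: "w n \<ge> 0" for n
    unfolding w_def by (intro sum_nonneg mult_nonneg_nonneg nonneg') auto
  have w_sum: "(\<Sum>n<M. w n) \<le> real p * (norm x)\<^sup>2" for M
  proof -
    have "(\<Sum>n<M. w n) = (\<Sum>s<p. \<Sum>n<M. real (n choose s) * defect T (Suc s) ((L ^^ Suc n) x))"
      unfolding w_def by (rule sum.swap)
    also have "\<dots> \<le> (\<Sum>s<p. (norm x)\<^sup>2)"
      by (intro sum_mono defect_weighted_sum_le[OF contr step]) auto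
    finally show ?thesis by simp
  qed
  obtain n where n: "n \<ge> N" "real (Suc n) * w n \<le> 1"
    using bounded_sums_imp_frequently_small[OF w_nonneg w_sum] by blast
  let ?y = "(L ^^ Suc n) x"
  have "(norm ((T ^^ Suc n) ?y))\<^sup>2 \<le> (\<Sum>k<Suc p. real (Suc n choose k) * defect T k ?y)"
    using newton_forward_difference_le[of "\<lambda>r n. defect T r ((T ^^ n) ?y)" "Suc p" "Suc n", OF orbit]
      concave by (simp del: funpow.simps sum.lessThan_Suc)
  also have "\<dots> = (norm ?y)\<^sup>2 + (\<Sum>s<p. real (Suc n choose Suc s) * defect T (Suc s) ?y)"
    by (subst sum.lessThan_Suc_shift) (simp del: binomial_Suc_Suc funpow.simps)
  also have "\<dots> \<le> (norm x)\<^sup>2 + (\<Sum>s<p. real (Suc n) * real (n choose s) * defect T (Suc s) ?y)"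
  proof (intro add_mono sum_mono mult_right_mono)
    show "(norm ?y)\<^sup>2 \<le> (norm x)\<^sup>2" using L_contr[of "Suc n"] by (simp add: power_mono)
    show "real (Suc n choose Suc s) \<le> real (Suc n) * real (n choose s)" for s
      unfolding of_nat_mult[symmetric] of_nat_le_iff Suc_times_binomial_eq by simp
  qed (use nonneg' in auto)
  also have "\<dots> = (norm x)\<^sup>2 + real (Suc n) * w n"
    by (simp add: w_def sum_distrib_left mult.assoc)
  also have "\<dots> \<le> (norm x)\<^sup>2 + 1" using n by simp
  finally show ?thesis using n(1) by (meson le_SucI)
qed

section \<open>The wandering subspace property\<close>

text \<open>
  The difference of consecutive remainders is $T^n(I-TL)L^nx$, and $I-TL$ maps into $\ker T^*$.
\<close>
lemma remainder_in_wandering_span: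
  fixes T :: "'a::chilbert_space \<Rightarrow> 'a"
  assumes T: "bounded_clinear T" "left_invertible T"
  shows "x - (T ^^ n) ((left_inv_op T ^^ n) x) \<in> cspan {(T ^^ n) x | n x. cadjoint T x = 0}"
    (is "_ \<in> ?M")
proof (induction n)
  case 0
  then show ?case by (simp add: complex_vector.span_zero)
next
  case (Suc n)
  let ?L = "left_inv_op T"
  let ?y = "(?L ^^ n) x"
  have diff: "(T ^^ n) (a - b) = (T ^^ n) a - (T ^^ n) b" for a b
    by (induction n) (simp_all add: bounded_clinearD[OF T(1)])
  have "cadjoint T (?y - T (?L ?y)) = 0"
    using left_inv_op_normal_equation(2)[OF T] linear_cadjoint[OF T(1)] by (simp add: linear_diff)
  then have "(T ^^ n) (?y - T (?L ?y)) \<in> ?M"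
    by (intro complex_vector.span_base) auto
  then have "(x - (T ^^ n) ?y) + (T ^^ n) (?y - T (?L ?y)) \<in> ?M"
    using Suc by (rule complex_vector.span_add[rotated])
  then show ?case by (simp add: diff funpow_swap1)
qed

text \<open>
  The convex set $C_k$ consists of the vectors of norm at most $c$ in the range of $T^k$ that differ
  from $x$ by an element of the closed span $M$. It contains a remainder for every $k$, and a common point
  lies in all ranges, so it is $0$ by analyticity; hence $x = x - 0$ belongs to $M$.
\<close>
lemma wandering_subspace_property_if_remainders_bounded:
  fixes T :: "'a::chilbert_space \<Rightarrow> 'a"
  assumes T: "bounded_clinear T" "left_invertible T" and analytic: "analytic_op T"
    and bound: "\<And>x. \<exists>c. \<forall>N. \<exists>n\<ge>N. norm ((T ^^ n) ((left_inv_op T ^^ n) x)) \<le> c"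
  shows "wandering_subspace_property T"
  unfolding wandering_subspace_property_def
proof (intro set_eqI iffI UNIV_I)
  fix x :: 'a
  let ?M = "cspan {(T ^^ n) x | n x. cadjoint T x = 0}"
  obtain c where c: "\<And>N. \<exists>n\<ge>N. norm ((T ^^ n) ((left_inv_op T ^^ n) x)) \<le> c"
    using bound by blast
  have subspace_M: "subspace ?M"
    by (auto simp: subspace_def scaleR_scaleC complex_vector.span_zero complex_vector.span_add
        complex_vector.span_scale)
  then have convex_clM: "convex (closure ?M)" by (intro convex_closure subspace_imp_convex)
  have range_mono: "range (T ^^ n) \<subseteq> range (T ^^ k)" if "k \<le> n" for k n
    using that by (metis (no_types, lifting) le_add_diff_inverse funpow_add image_comp image_mono subset_UNIV)
  define C where "C k = range (T ^^ k) \<inter> cball 0 c \<inter> (\<lambda>z. x - z) -` closure ?M" for k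
  have "(\<Inter>k. C k) \<noteq> {}"
  proof (rule nested_closed_convex_Int_nonempty)
    fix k
    show "closed (C k)" unfolding C_def
      by (intro closed_Int left_invertible_imp_closed_range[OF T] closed_cball closed_vimage
          closed_closure continuous_intros)
    have "linear (T ^^ k)"
    proof (induction k)
      case (Suc k)
      then show ?case
        using linear_compose[OF Suc bounded_linear.linear[OF bounded_clinearD(1)[OF T(1)]]] by (simp add: comp_def)
    qed (simp add: linear_id[unfolded id_def] id_def)
    then have "convex (range (T ^^ k))" by (simp add: convex_linear_image)
    moreover have "convex ((\<lambda>z. x - z) -` closure ?M)"
    proof (rule convexI)
      fix a b :: 'a and u v :: real
      assume *: "a \<in> (\<lambda>z. x - z) -` closure ?M" "b \<in> (\<lambda>z. x - z) -` closure ?M"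
        "0 \<le> u" "0 \<le> v" "u + v = 1"
      then have "u *\<^sub>R (x - a) + v *\<^sub>R (x - b) \<in> closure ?M"
        using convexD[OF convex_clM] by simp
      also have "u *\<^sub>R (x - a) + v *\<^sub>R (x - b) = (u + v) *\<^sub>R x - (u *\<^sub>R a + v *\<^sub>R b)"
        by (simp add: algebra_simps)
      finally show "u *\<^sub>R a + v *\<^sub>R b \<in> (\<lambda>z. x - z) -` closure ?M" using * by simp
    qed
    ultimately show "convex (C k)" unfolding C_def by (intro convex_Int convex_cball)
    obtain n where n: "n \<ge> k" "norm ((T ^^ n) ((left_inv_op T ^^ n) x)) \<le> c" using c by blast
    have "(T ^^ n) ((left_inv_op T ^^ n) x) \<in> C k"
      using n range_mono[OF n(1)] remainder_in_wandering_span[OF T, of x n] closure_subset[of ?M]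
      by (auto simp: C_def)
    then show "C k \<noteq> {}" by auto
  next
    show "decseq C" using range_mono by (force simp: decseq_def C_def)
    show "bounded (C 0)" by (auto simp: C_def intro: bounded_subset[OF bounded_cball])
  qed
  then obtain z where z: "\<And>k. z \<in> C k" by auto
  then have "z \<in> (\<Inter>k. range (T ^^ k))" by (auto simp: C_def)
  then have "z = 0" using analytic unfolding analytic_op_def by blast
  with z[of 0] show "x \<in> closure ?M" by (simp add: C_def)
qed

theorem theorem1p3:
  fixes T :: "'a::chilbert_space \<Rightarrow> 'a" and m :: nat
  assumes "separable_space (euclidean :: 'a topology)"
    and "bounded_clinear T"
    and "analytic_op T"
    and "left_invertible T"
    and "m \<ge> 2"
    and "m_concave m T"
    and "\<And>r. r \<in> {1..m - 2} \<Longrightarrow>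
      op_series_le
        (\<lambda>k. (cadjoint (left_inv_op T) ^^ k) \<circ> beta (r + 1) T \<circ> (left_inv_op T ^^ k))
        (beta r T)"
  shows "wandering_subspace_property T"
proof -
  note T = assms(2,4)
  let ?L = "left_inv_op T"
  define p where "p = m - 1"
  have p: "p \<ge> 1" "m = Suc p" using \<open>m \<ge> 2\<close> by (auto simp: p_def)
  have concave: "defect T (Suc p) x \<le> 0" for x
  proof -
    have "cinner (beta m T x) x \<le> 0"
      using \<open>m_concave m T\<close> cinner_add_left[of 0 0 x]
      unfolding m_concave_def op_le_def by (metis add_cancel_right_right add_0)
    then show ?thesis by (simp add: cinner_beta[OF T(1)] p less_eq_complex_def)
  qed
  have series: "summable (\<lambda>k. defect T (Suc r) ((?L ^^ Suc k) x))"
    "(\<Sum>k. defect T (Suc r) ((?L ^^ Suc k) x)) \<le> defect T r x" if "1 \<le> r" "r < p" for r x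
  proof -
    have r: "r \<in> {1..m - 2}" using that p by auto
    have term_eq: "cinner (((cadjoint ?L ^^ k) \<circ> beta (r + 1) T \<circ> (?L ^^ k)) x) x =
        complex_of_real (defect T (Suc r) ((?L ^^ k) x))" for k
      by (simp add: cinner_funpow_cadjoint[OF bounded_clinear_left_inv_op[OF T]] cinner_beta[OF T(1)])
    have *: "summable (\<lambda>k. complex_of_real (defect T (Suc r) ((?L ^^ Suc k) x)))"
      "(\<Sum>k. complex_of_real (defect T (Suc r) ((?L ^^ Suc k) x))) \<le> complex_of_real (defect T r x)"
      using spec[OF assms(7)[OF r, unfolded op_series_le_def], of x]
      unfolding term_eq cinner_beta[OF T(1)] by simp_all
    show sm: "summable (\<lambda>k. defect T (Suc r) ((?L ^^ Suc k) x))"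
      using *(1) by (simp only: summable_of_real_iff)
    show "(\<Sum>k. defect T (Suc r) ((?L ^^ Suc k) x)) \<le> defect T r x"
      using *(2) unfolding suminf_of_real[OF sm, symmetric] by (simp add: less_eq_complex_def)
  qed
  have "\<exists>c. \<forall>N. \<exists>n\<ge>N. norm ((T ^^ n) ((?L ^^ n) x)) \<le> c" for x
  proof -
    have "\<exists>n\<ge>N. (norm ((T ^^ n) ((?L ^^ n) x)))\<^sup>2 \<le> (norm x)\<^sup>2 + 1" for N
      using norm_T_left_inv_op_le[OF T] series \<open>p \<ge> 1\<close> concave
      by (rule norm_power_left_inverse_frequently_bounded)
    then show ?thesis by (meson real_le_rsqrt)
  qed
  then show ?thesis
    by (rule wandering_subspace_property_if_remainders_bounded[OF T assms(3)])
qed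

end
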